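(* Let $n\ge1$, let $s_1,s_2$ be non-negative integers and let $x_1,x_2\in\mathbb{C}\setminus\{1\}$. Let $\widetilde{\mathcal{W}}_n$ be the Weyl group of $SU(n)$, that is, $\mathcal{S}_n$ acting by permutation of coordinates on the subspace $\mathcal{T}=\{(y_1,\dots,y_n)\in\mathbb{C}^n:\sum_i y_i=0\}$, and for $w\in\widetilde{\mathcal{W}}_n$ let $Z_{\widetilde{\mathcal{W}}_n}(x)(w):=\det(I-xw|_{\mathcal{T}})$. Then, for $w$ uniformly distributed, $$\mathbb{E}\left[Z_{\widetilde{\mathcal{W}}_n}^{s_1}(x_1)Z_{\widetilde{\mathcal{W}}_n}^{s_2}(x_2)\right]=\left[\frac{\prod_{k_1=0}^{s_1}\prod_{k_2=0}^{s_2}\left(1-x_1^{k_1}x_2^{k_2}t\right)^{\binom{s_1}{k_1}\binom{s_2}{k_2}(-1)^{k_1+k_2+1}}}{(1-x_1)^{s_1}(1-x_2)^{s_2}}\right]_n.$$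
   Context: For a power series $h(t)=\sum_n h_nt^n$ in $t$ write $[h(t)]_n:=h_n$; the right-hand side is expanded as a power series in $t$ at $0$. The expectation is over $w$ coming from a uniformly distributed element of $\mathcal{S}_n$. *)

theory Defs
  imports
    "HOL-Probability.Probability_Mass_Function"
    "HOL-Computational_Algebra.Formal_Power_Series"
    "HOL-Combinatorics.Permutations"
    "Jordan_Normal_Form.DL_Rank"
begin

hide_const (open) Finite_Cartesian_Product.vec Finite_Cartesian_Product.vec_nth
  Determinants.det
hide_type (open) Finite_Cartesian_Product.vec
unbundle no vec_syntax

definition is_basis_list :: "nat \<Rightarrow> 'a::field vec set \<Rightarrow> 'a vec list \<Rightarrow> bool" where
  "is_basis_list n T vs \<longleftrightarrow>
     set vs \<subseteq> carrier_vec n \<and> distinct vs \<and>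
     \<not> module.lin_dep class_ring (module_vec TYPE('a) n) (set vs) \<and>
     LinearCombinations.module.span class_ring (module_vec TYPE('a) n) (set vs) = T"

text \<open>The determinant of the restriction \<open>F|\<^sub>T\<close> of a linear operator \<open>F\<close> on \<open>K\<^sup>n\<close> to an
  invariant subspace \<open>T\<close>: the determinant of the matrix \<open>M\<close> of \<open>F|\<^sub>T\<close> with respect to any
  basis \<open>vs\<close> of \<open>T\<close>. Column \<open>j\<close> of \<open>M\<close> holds the coordinates of \<open>F *\<^sub>v (vs ! j)\<close>, which is
  the matrix equation below. The value does not depend on the basis (lemma \<open>det_on_eqI\<close>).
  For \<open>T = 0\<close> it is the determinant of the empty matrix, that is, 1.\<close>

definition det_on :: "nat \<Rightarrow> 'a::field vec set \<Rightarrow> 'a mat \<Rightarrow> 'a" where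
  "det_on n T F = (THE d. \<exists>vs M. is_basis_list n T vs \<and>
     M \<in> carrier_mat (length vs) (length vs) \<and>
     F * mat_of_cols n vs = mat_of_cols n vs * M \<and>
     d = det M)"

lemma det_on_eqI:
  fixes F :: "'a::field mat"
  assumes F: "F \<in> carrier_mat n n"
    and bs: "is_basis_list n T bs" and M: "M \<in> carrier_mat (length bs) (length bs)"
    and eq: "F * mat_of_cols n bs = mat_of_cols n bs * M"
  shows "det_on n T F = det M"
proof -
  interpret vec_space "TYPE('a)" n .
  have fac: "\<exists>P \<in> carrier_mat (length us) (length ws). mat_of_cols n ws = mat_of_cols n us * P"
    if us: "is_basis_list n T us" and ws: "is_basis_list n T ws" for us ws
  proof -
    let ?U = "mat_of_cols n us"
    have U: "?U \<in> carrier_mat n (length us)" by simp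
    have cU: "cols ?U = us" using us by (simp add: is_basis_list_def)
    have "\<exists>c \<in> carrier_vec (length us). ws ! j = ?U *\<^sub>v c" if "j < length ws" for j
    proof -
      have wc: "ws ! j \<in> carrier_vec n" using ws that by (auto simp: is_basis_list_def)
      have "set ws \<subseteq> span (set ws)" using ws in_own_span[of "set ws"] by (simp add: is_basis_list_def)
      hence "ws ! j \<in> span (set us)" using us ws that by (auto simp: is_basis_list_def)
      hence "ws ! j \<in> col_space ?U" using cU by (simp add: col_space_def)
      hence "ws ! j \<in> {y \<in> carrier_vec n. \<exists>x \<in> carrier_vec (length us). ?U *\<^sub>v x = y}"
        using col_space_eq[OF U] by simp
      thus ?thesis by (smt (verit) mem_Collect_eq)
    qed
    hence "\<forall>j. \<exists>c. j < length ws \<longrightarrow> c \<in> carrier_vec (length us) \<and> ws ! j = ?U *\<^sub>v c"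
      by blast
    from choice[OF this] obtain c where
      c: "\<And>j. j < length ws \<Longrightarrow> c j \<in> carrier_vec (length us) \<and> ws ! j = ?U *\<^sub>v c j"
      by blast
    define P where "P = mat_of_cols (length us) (map c [0..<length ws])"
    have P: "P \<in> carrier_mat (length us) (length ws)" unfolding P_def by (intro carrier_matI) simp_all
    have "mat_of_cols n ws = ?U * P"
    proof (rule mat_col_eqI)
      fix j assume "j < dim_col (?U * P)"
      hence j: "j < length ws" using P by simp
      have wc: "ws ! j \<in> carrier_vec n" using ws j by (auto simp: is_basis_list_def)
      have "col (?U * P) j = ?U *\<^sub>v col P j" using col_mult2[OF U P j] .
      also have "col P j = c j" unfolding P_def using c[OF j] j by (subst col_mat_of_cols) auto
      finally show "col (mat_of_cols n ws) j = col (?U * P) j" using c[OF j] j wc by simp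
    qed (use P in auto)
    thus ?thesis using P by blast
  qed
  have canc: "A = B" if us: "is_basis_list n T us" and A: "A \<in> carrier_mat (length us) k"
    and B: "B \<in> carrier_mat (length us) k" and e: "mat_of_cols n us * A = mat_of_cols n us * B"
    for us A B k
  proof (rule mat_col_eqI)
    let ?U = "mat_of_cols n us"
    have U: "?U \<in> carrier_mat n (length us)" by simp
    have cU: "cols ?U = us" using us by (simp add: is_basis_list_def)
    fix j assume "j < dim_col B"
    hence j: "j < k" using B by simp
    let ?v = "col A j - col B j"
    have ca: "col A j \<in> carrier_vec (length us)" "col B j \<in> carrier_vec (length us)"
      using col_carrier_vec[OF j A] col_carrier_vec[OF j B] by auto
    have "?U *\<^sub>v col A j = ?U *\<^sub>v col B j"
      using e col_mult2[OF U A j] col_mult2[OF U B j] by simp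
    hence "?U *\<^sub>v ?v = 0\<^sub>v n"
      using mult_minus_distrib_mat_vec[OF U ca] U by auto
    moreover have "lin_indpt (set (cols ?U))" "distinct (cols ?U)"
      using us cU by (auto simp: is_basis_list_def)
    ultimately have v0: "?v = 0\<^sub>v (length us)"
      using lin_depI[OF U, of ?v] ca by auto
    show "col A j = col B j"
    proof (rule eq_vecI)
      fix i assume i: "i < dim_vec (col B j)"
      have "i < length us" using i carrier_vecD[OF ca(2)] by simp
      hence "?v $ i = 0" using v0 by simp
      thus "col A j $ i = col B j $ i" using i ca by simp
    qed (use A B in auto)
  qed (use A B in auto)
  have "det N = det M" if ws: "is_basis_list n T ws"
    and N: "N \<in> carrier_mat (length ws) (length ws)"
    and eN: "F * mat_of_cols n ws = mat_of_cols n ws * N" for ws N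
  proof -
    let ?a = "length bs" and ?b = "length ws"
    let ?V = "mat_of_cols n bs" and ?W = "mat_of_cols n ws"
    have V: "?V \<in> carrier_mat n ?a" and W: "?W \<in> carrier_mat n ?b" by auto
    obtain P where P: "P \<in> carrier_mat ?a ?b" and WP: "?W = ?V * P" using fac[OF bs ws] by blast
    obtain Q where Q: "Q \<in> carrier_mat ?b ?a" and VQ: "?V = ?W * Q" using fac[OF ws bs] by blast
    have PQ: "P * Q = 1\<^sub>m ?a"
    proof (rule canc[OF bs])
      have "?V * (P * Q) = ?V * P * Q" using assoc_mult_mat[OF V P Q] by (rule sym)
      also have "\<dots> = ?V" by (simp only: WP[symmetric] VQ[symmetric])
      finally show "?V * (P * Q) = ?V * 1\<^sub>m ?a" using right_mult_one_mat[OF V] by simp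
    qed (use P Q in auto)
    have dim: "length us = vectorspace.dim class_ring (vs T)" if us: "is_basis_list n T us" for us
    proof -
      have "maximal (set us) (\<lambda>S. S \<subseteq> set us \<and> lin_indpt S)"
        using us by (auto simp: maximal_def is_basis_list_def)
      hence "vectorspace.dim class_ring (span_vs (set us)) = card (set us)"
        using us by (intro dim_span) (auto simp: is_basis_list_def)
      thus ?thesis using us by (simp add: is_basis_list_def distinct_card)
    qed
    have ab: "?a = ?b" using dim[OF bs] dim[OF ws] by simp
    have "?V * (M * P) = ?V * (P * N)"
    proof -
      have "?V * (M * P) = ?V * M * P" using assoc_mult_mat[OF V M P] by (rule sym)
      also have "\<dots> = F * (?V * P)" using assoc_mult_mat[OF F V P] by (simp only: eq)
      also have "\<dots> = ?V * P * N" by (simp only: WP[symmetric] eN)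
      also have "\<dots> = ?V * (P * N)" by (rule assoc_mult_mat[OF V P N])
      finally show ?thesis .
    qed
    hence "M * P = P * N" by (rule canc[OF bs mult_carrier_mat[OF M P] mult_carrier_mat[OF P N]])
    hence "det (M * P) = det (P * N)" by simp
    hence "det M * det P = det P * det N" using det_mult[of M ?b P] det_mult[of P ?b N] M P N ab by auto
    moreover have "det P * det Q = 1" using arg_cong[OF PQ, of det] det_mult[of P ?b Q] P Q ab by simp
    ultimately show ?thesis by (auto simp: mult.commute[of _ "det P"])
  qed
  thus ?thesis unfolding det_on_def using bs M eq by (blast intro!: the_equality)
qed

definition perm_matrix :: "nat \<Rightarrow> (nat \<Rightarrow> nat) \<Rightarrow> 'a::semiring_1 mat" where
  "perm_matrix n p = mat n n (\<lambda>(i, j). if i = p j then 1 else 0)"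

lemma perm_matrix_mult_vec:
  assumes p: "p permutes {..<n}" and y: "y \<in> carrier_vec n" and i: "i < n"
  shows "(perm_matrix n p *\<^sub>v y) $ p i = y $ i"
proof -
  have pi: "p i < n" using p i permutes_in_image by fastforce
  have inj: "p i = p j \<longleftrightarrow> j = i" for j using permutes_inj[OF p] by (auto dest: injD)
  have "(perm_matrix n p *\<^sub>v y) $ p i = (\<Sum>j = 0..<n. (if p i = p j then 1 else 0) * y $ j)"
    using y pi by (simp add: perm_matrix_def scalar_prod_def)
  also have "\<dots> = y $ i" using i by (simp add: inj sum.delta if_distrib[of "\<lambda>a. a * _"] cong: if_cong)
  finally show ?thesis .
qed

definition sum_zero_space :: "nat \<Rightarrow> complex vec set" where
  "sum_zero_space n = {y \<in> carrier_vec n. (\<Sum>i<n. y $ i) = 0}"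

definition Z_weyl_SU :: "nat \<Rightarrow> complex \<Rightarrow> (nat \<Rightarrow> nat) \<Rightarrow> complex" where
  "Z_weyl_SU n x p = det_on n (sum_zero_space n) (1\<^sub>m n - x \<cdot>\<^sub>m perm_matrix n p)"

end

theory Submission
  imports Defs
begin

text \<open>On the full space \<open>\<complex>\<^sup>n\<close> the determinant of \<open>I - x P\<close>, for a permutation matrix \<open>P\<close>, differs
  from the one on the sum-zero subspace only by the factor \<open>1 - x\<close>: all column sums of
  \<open>I - x P\<close> equal \<open>1 - x\<close>, so the operator acts as \<open>1 - x\<close> on the quotient by the subspace
  (lemma \<open>det_eq_mult_det_on_sum_zero_space\<close>). This accounts for the denominator, and it
  remains to compute the average \<open>a\<^sub>n\<close> of \<open>det (I - x\<^sub>1 P)^s\<^sub>1 det (I - x\<^sub>2 P)^s\<^sub>2\<close>.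

  Put \<open>f j = (1 - x\<^sub>1^j)^s\<^sub>1 (1 - x\<^sub>2^j)^s\<^sub>2\<close>, the contribution of a cycle of length \<open>j\<close>.
  Conditioning on the length of the cycle through the last point gives
  \<open>(n + 1) a\<^bsub>n + 1\<^esub> = (\<Sum>j\<le>n. f (j + 1) a\<^bsub>n - j\<^esub>)\<close>. The cycle decomposition
  itself is not needed: allow a separate weight \<open>d j\<close> in place of \<open>x\<close> for each point \<open>j\<close>. If the
  last point is fixed, it contributes the factor \<open>1 - d n\<close>; otherwise one column operation removes it and multiplies
  the weight of its preimage by \<open>d n\<close> (lemmas \<open>det_wperm_fixed_last\<close>,
  \<open>det_wperm_insert_last\<close>). Iterating this while the last point has weight \<open>x^m\<close> walks along
  its cycle (lemma \<open>wperm_moment_long_cycle\<close>).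

  The binomial theorem writes \<open>f j\<close> as a signed sum of the powers
  \<open>(x\<^sub>1^k\<^sub>1 x\<^sub>2^k\<^sub>2)^j\<close>, so \<open>\<Sum>j. f (j + 1) t^j\<close> is the logarithmic derivative of the product in
  the theorem. The coefficients of that product therefore satisfy the same recurrence, with
  the same initial value 1.\<close>

section \<open>Weighted permutation matrices\<close>

text \<open>The matrix \<open>I - P D\<close> with \<open>P\<close> the permutation matrix of \<open>p\<close> and \<open>D\<close> the diagonal matrix of
  the weights \<open>d\<close>: column \<open>j\<close> is \<open>e\<^sub>j - d j e\<^bsub>p j\<^esub>\<close>.\<close>

definition wperm_matrix :: "nat \<Rightarrow> (nat \<Rightarrow> 'a::comm_ring_1) \<Rightarrow> (nat \<Rightarrow> nat) \<Rightarrow> 'a mat" where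
  "wperm_matrix n d p =
     mat n n (\<lambda>(i, j). (if i = j then 1 else 0) - (if i = p j then d j else 0))"

lemma wperm_matrix_carrier [simp]: "wperm_matrix n d p \<in> carrier_mat n n"
  by (simp add: wperm_matrix_def)

text \<open>Laplace expansion along a last row that vanishes off the diagonal.\<close>

lemma det_last_row_zero:
  fixes A :: "'a::comm_ring_1 mat"
  assumes A: "A \<in> carrier_mat (Suc m) (Suc m)" and z: "\<And>j. j < m \<Longrightarrow> A $$ (m, j) = 0"
  shows "det A = A $$ (m, m) * det (mat m m (\<lambda>ij. A $$ ij))"
proof -
  have "det A = (\<Sum>j<Suc m. A $$ (m, j) * cofactor A m j)"
    by (rule laplace_expansion_row[OF A]) simp
  also have "\<dots> = A $$ (m, m) * det (mat_delete A m m)"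
    using z by (simp add: cofactor_def)
  also have "mat_delete A m m = mat m m (\<lambda>ij. A $$ ij)"
    using A by (intro eq_matI) (auto simp: mat_delete_def)
  finally show ?thesis .
qed

lemma det_conjugate_perm:
  fixes A :: "'a::comm_ring_1 mat"
  assumes A: "A \<in> carrier_mat n n" and s: "s permutes {..<n}"
  shows "det (mat n n (\<lambda>(i, j). A $$ (s i, s j))) = det A"
proof -
  have s0: "s permutes {0..<n}" using s by (simp add: lessThan_atLeast0)
  have sn: "s i < n" if "i < n" for i using permutes_in_image[OF s] that by fastforce
  let ?B = "mat n n (\<lambda>(i, j). A $$ (i, s j))"
  have B: "?B \<in> carrier_mat n n" by simp
  have "mat n n (\<lambda>(i, j). A $$ (s i, s j)) = mat n n (\<lambda>(i, j). ?B $$ (s i, j))"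
    by (intro eq_matI) (auto simp: sn)
  hence "det (mat n n (\<lambda>(i, j). A $$ (s i, s j))) = signof s * det ?B"
    using det_permute_rows[OF B s0] by simp
  also have "det ?B = det (transpose_mat ?B)" using det_transpose[OF B] by simp
  also have "transpose_mat ?B = mat n n (\<lambda>(i, j). transpose_mat A $$ (s i, j))"
    using A by (intro eq_matI) (auto simp: sn)
  also have "det \<dots> = signof s * det (transpose_mat A)"
    by (rule det_permute_rows) (use A s0 in auto)
  also have "det (transpose_mat A) = det A" by (rule det_transpose[OF A])
  also have "signof s * (signof s * det A) = of_int (sign s * sign s) * det A"
    by (simp only: of_int_mult mult.assoc)
  finally show ?thesis by simp
qed

lemma det_wperm_fixed_last:
  assumes q: "q permutes {..<n}"
  shows "det (wperm_matrix (Suc n) d q) = (1 - d n) * det (wperm_matrix n d q)"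
proof -
  have qn: "q n = n" by (rule permutes_not_in[OF q]) simp
  have ql: "q j < n" if "j < n" for j using permutes_in_image[OF q] that by fastforce
  have "mat n n (\<lambda>ij. wperm_matrix (Suc n) d q $$ ij) = wperm_matrix n d q"
    by (intro eq_matI) (auto simp: wperm_matrix_def)
  moreover have "wperm_matrix (Suc n) d q $$ (n, n) = 1 - d n"
    by (simp add: wperm_matrix_def qn)
  moreover have "wperm_matrix (Suc n) d q $$ (n, j) = 0" if "j < n" for j
    using that ql[OF that] by (simp add: wperm_matrix_def)
  ultimately show ?thesis
    using det_last_row_zero[of "wperm_matrix (Suc n) d q" n] by simp
qed

text \<open>Composing \<open>q\<close> with the transposition inserts the point \<open>n\<close> between \<open>i\<close> and \<open>q i\<close>. Adding
  \<open>d i\<close> times column \<open>n\<close>, which is \<open>e\<^sub>n - d n e\<^bsub>q i\<^esub>\<close>, to column \<open>i\<close>, which is \<open>e\<^sub>i - d i e\<^sub>n\<close>, leaves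
  \<open>e\<^sub>i - d i d n e\<^bsub>q i\<^esub>\<close>, so that the last row becomes \<open>e\<^sub>n\<close> and the new point can be dropped.\<close>

lemma det_wperm_insert_last:
  assumes q: "q permutes {..<n}" and i: "i < n"
  shows "det (wperm_matrix (Suc n) d (Transposition.transpose n (q i) \<circ> q)) =
         det (wperm_matrix n (d(i := d i * d n)) q)"
proof -
  define p where "p = Transposition.transpose n (q i) \<circ> q"
  have qn: "q n = n" by (rule permutes_not_in[OF q]) simp
  have ql: "q j < n" if "j < n" for j using permutes_in_image[OF q] that by fastforce
  have inj: "q j = q k \<longleftrightarrow> j = k" for j k using permutes_inj[OF q] by (auto dest: injD)
  have pn: "p n = q i" by (simp add: p_def qn)
  have pi: "p i = n" by (simp add: p_def)
  have pj: "p j = q j" if "j < n" "j \<noteq> i" for j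
    using ql[OF that(1)] that(2) inj[of j i] by (simp add: p_def Transposition.transpose_def)
  let ?A = "wperm_matrix (Suc n) d p"
  have A: "?A \<in> carrier_mat (Suc n) (Suc n)" by (rule wperm_matrix_carrier)
  have Aij: "?A $$ (a, b) = (if a = b then 1 else 0) - (if a = p b then d b else 0)"
    if "a \<le> n" "b \<le> n" for a b
    using that by (simp add: wperm_matrix_def)
  define B where "B = addcol (d i) i n ?A"
  have B: "B \<in> carrier_mat (Suc n) (Suc n)" by (intro carrier_matI) (simp_all add: B_def wperm_matrix_def)
  have Bij: "B $$ (a, b) = (if b = i then d i * ?A $$ (a, n) + ?A $$ (a, i) else ?A $$ (a, b))"
    if "a \<le> n" "b \<le> n" for a b
    using that i carrier_matD[OF A] by (simp add: B_def)
  have "det ?A = det B" unfolding B_def using i by (intro det_addcol[OF _ _ A, symmetric]) auto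
  also have "\<dots> = B $$ (n, n) * det (mat n n (\<lambda>ij. B $$ ij))"
  proof (rule det_last_row_zero[OF B])
    fix j assume j: "j < n"
    show "B $$ (n, j) = 0"
    proof (cases "j = i")
      case True
      thus ?thesis using i ql[OF i] by (simp add: Bij Aij pn pi)
    next
      case False
      thus ?thesis using j ql[OF j] by (simp add: Bij Aij pj)
    qed
  qed
  also have "B $$ (n, n) = 1" using i ql[OF i] by (simp add: Bij Aij pn)
  also have "mat n n (\<lambda>ij. B $$ ij) = wperm_matrix n (d(i := d i * d n)) q"
  proof (rule eq_matI)
    fix a b
    assume "a < dim_row (wperm_matrix n (d(i := d i * d n)) q)"
      and "b < dim_col (wperm_matrix n (d(i := d i * d n)) q)"
    hence ab: "a < n" "b < n" by (simp_all add: wperm_matrix_def)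
    have "mat n n (\<lambda>ij. B $$ ij) $$ (a, b) = B $$ (a, b)" using ab by simp
    also have "\<dots> = wperm_matrix n (d(i := d i * d n)) q $$ (a, b)"
    proof (cases "b = i")
      case True
      thus ?thesis using ab by (simp add: Bij Aij pn pi wperm_matrix_def)
    next
      case False
      thus ?thesis using ab by (simp add: Bij Aij pj wperm_matrix_def)
    qed
    finally show "mat n n (\<lambda>ij. B $$ ij) $$ (a, b) =
      wperm_matrix n (d(i := d i * d n)) q $$ (a, b)" .
  qed (simp_all add: wperm_matrix_def)
  finally show ?thesis by (simp only: p_def mult_1)
qed

lemma det_wperm_conjugate:
  assumes s: "s permutes {..<n}" and pq: "s \<circ> q = p \<circ> s"
  shows "det (wperm_matrix n (d \<circ> s) q) = det (wperm_matrix n d p)"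
proof -
  have sn: "s i < n" if "i < n" for i using permutes_in_image[OF s] that by fastforce
  have inj: "s j = s k \<longleftrightarrow> j = k" for j k using permutes_inj[OF s] by (auto dest: injD)
  have eq: "s i = p (s j) \<longleftrightarrow> i = q j" for i j
    using fun_cong[OF pq, of j] inj[of i "q j"] by simp
  have "wperm_matrix n (d \<circ> s) q = mat n n (\<lambda>(i, j). wperm_matrix n d p $$ (s i, s j))"
    by (intro eq_matI) (auto simp: wperm_matrix_def sn inj eq)
  thus ?thesis using det_conjugate_perm[OF _ s, of "wperm_matrix n d p"] by simp
qed

section \<open>The recurrence for the sum over all permutations\<close>

text \<open>The sum over all permutations, not divided by \<open>n!\<close>, of the product of powers of the two
  determinants, with arbitrary weights \<open>d1\<close>, \<open>d2\<close> in place of the scalars \<open>x\<^sub>1\<close>, \<open>x\<^sub>2\<close>.\<close>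

definition wperm_moment ::
    "nat \<Rightarrow> nat \<Rightarrow> nat \<Rightarrow> (nat \<Rightarrow> 'a::comm_ring_1) \<Rightarrow> (nat \<Rightarrow> 'a) \<Rightarrow> 'a" where
  "wperm_moment s1 s2 n d1 d2 =
     (\<Sum>p | p permutes {..<n}. det (wperm_matrix n d1 p) ^ s1 * det (wperm_matrix n d2 p) ^ s2)"

lemma wperm_moment_0 [simp]: "wperm_moment s1 s2 0 d1 d2 = 1"
  by (simp add: wperm_moment_def wperm_matrix_def)

lemma wperm_moment_cong:
  assumes "\<And>i. i < n \<Longrightarrow> d1 i = e1 i" and "\<And>i. i < n \<Longrightarrow> d2 i = e2 i"
  shows "wperm_moment s1 s2 n d1 d2 = wperm_moment s1 s2 n e1 e2"
proof -
  have "wperm_matrix n d1 = wperm_matrix n e1" "wperm_matrix n d2 = wperm_matrix n e2"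
    using assms by (auto simp: wperm_matrix_def fun_eq_iff intro!: eq_matI)
  thus ?thesis by (simp add: wperm_moment_def)
qed

lemma wperm_moment_transpose:
  assumes "i < n" "k < n"
  defines "s \<equiv> Transposition.transpose i k"
  shows "wperm_moment s1 s2 n (d1 \<circ> s) (d2 \<circ> s) = wperm_moment s1 s2 n d1 d2"
proof -
  have s: "s permutes {..<n}" unfolding s_def using assms by (intro permutes_swap_id) auto
  have ss: "s (s j) = j" for j by (simp add: s_def)
  show ?thesis unfolding wperm_moment_def
  proof (rule sum.reindex_bij_witness[where i = "\<lambda>p. s \<circ> p \<circ> s" and j = "\<lambda>p. s \<circ> p \<circ> s"])
    fix p assume "p \<in> {p. p permutes {..<n}}"
    thus "s \<circ> p \<circ> s \<in> {p. p permutes {..<n}}" "s \<circ> p \<circ> s \<in> {p. p permutes {..<n}}"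
      using s by (auto intro!: permutes_compose)
    have "s \<circ> p = (s \<circ> p \<circ> s) \<circ> s" by (simp add: fun_eq_iff ss)
    hence "det (wperm_matrix n d (s \<circ> p \<circ> s)) = det (wperm_matrix n (d \<circ> s) p)" for d :: "nat \<Rightarrow> 'a"
      by (rule det_wperm_conjugate[OF s, symmetric])
    thus "det (wperm_matrix n d1 (s \<circ> p \<circ> s)) ^ s1 * det (wperm_matrix n d2 (s \<circ> p \<circ> s)) ^ s2 =
       det (wperm_matrix n (d1 \<circ> s) p) ^ s1 * det (wperm_matrix n (d2 \<circ> s) p) ^ s2"
      by (simp only:)
  qed (simp_all add: fun_eq_iff ss)
qed

lemma wperm_moment_Suc:
  "wperm_moment s1 s2 (Suc n) d1 d2 =
     (1 - d1 n) ^ s1 * (1 - d2 n) ^ s2 * wperm_moment s1 s2 n d1 d2 +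
     (\<Sum>i<n. wperm_moment s1 s2 n (d1(i := d1 i * d1 n)) (d2(i := d2 i * d2 n)))"
proof -
  let ?P = "{p. p permutes {..<n}}"
  let ?g = "\<lambda>m d1 d2 p. det (wperm_matrix m d1 p) ^ s1 * det (wperm_matrix m d2 p) ^ s2"
  let ?f = "?g (Suc n) d1 d2"
  have "wperm_moment s1 s2 (Suc n) d1 d2 =
      (\<Sum>b\<in>insert n {..<n}. \<Sum>q\<in>?P. ?f (Transposition.transpose n b \<circ> q))"
    unfolding wperm_moment_def lessThan_Suc by (rule sum_over_permutations_insert) auto
  also have "\<dots> = (\<Sum>q\<in>?P. ?f q) + (\<Sum>b<n. \<Sum>q\<in>?P. ?f (Transposition.transpose n b \<circ> q))"
    by simp
  also have "(\<Sum>q\<in>?P. ?f q) = (1 - d1 n) ^ s1 * (1 - d2 n) ^ s2 * wperm_moment s1 s2 n d1 d2"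
    unfolding wperm_moment_def sum_distrib_left
    by (intro sum.cong) (auto simp: det_wperm_fixed_last power_mult_distrib mult_ac)
  also have "(\<Sum>b<n. \<Sum>q\<in>?P. ?f (Transposition.transpose n b \<circ> q)) =
      (\<Sum>q\<in>?P. \<Sum>b<n. ?f (Transposition.transpose n b \<circ> q))" by (rule sum.swap)
  also have "\<dots> = (\<Sum>q\<in>?P. \<Sum>i<n. ?f (Transposition.transpose n (q i) \<circ> q))"
  proof (rule sum.cong[OF refl])
    fix q assume "q \<in> ?P"
    hence "bij_betw q {..<n} {..<n}" by (simp add: permutes_imp_bij)
    from sum.reindex_bij_betw[OF this, of "\<lambda>b. ?f (Transposition.transpose n b \<circ> q)"]
    show "(\<Sum>b<n. ?f (Transposition.transpose n b \<circ> q)) =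
      (\<Sum>i<n. ?f (Transposition.transpose n (q i) \<circ> q))" by (rule sym)
  qed
  also have "\<dots> = (\<Sum>q\<in>?P. \<Sum>i<n. ?g n (d1(i := d1 i * d1 n)) (d2(i := d2 i * d2 n)) q)"
    by (intro sum.cong refl) (simp add: det_wperm_insert_last)
  also have "\<dots> = (\<Sum>i<n. wperm_moment s1 s2 n (d1(i := d1 i * d1 n)) (d2(i := d2 i * d2 n)))"
    unfolding wperm_moment_def by (rule sum.swap)
  finally show ?thesis .
qed

text \<open>All points have weight \<open>x\<close>, except the last one, which stands for a path of \<open>m\<close> points
  already contracted to a single one. The index \<open>j\<close> counts the further points on its cycle:
  there are \<open>n! / (n - j)!\<close> ways to choose them in order, the completed cycle contributes the
  factor \<open>1 - x^(m + j)\<close>, and \<open>n - j\<close> points remain.\<close>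

lemma wperm_moment_long_cycle:
  fixes x1 x2 :: "'a::field_char_0"
  shows "wperm_moment s1 s2 (Suc n) ((\<lambda>_. x1)(n := x1 ^ m)) ((\<lambda>_. x2)(n := x2 ^ m)) =
    (\<Sum>j\<le>n. (1 - x1 ^ (m + j)) ^ s1 * (1 - x2 ^ (m + j)) ^ s2 *
       (fact n / fact (n - j)) * wperm_moment s1 s2 (n - j) (\<lambda>_. x1) (\<lambda>_. x2))"
proof (induction n arbitrary: m)
  case 0
  show ?case by (simp add: wperm_moment_Suc)
next
  case (Suc n)
  let ?f = "\<lambda>m. (1 - x1 ^ m) ^ s1 * (1 - x2 ^ m) ^ s2"
  let ?B = "\<lambda>n. wperm_moment s1 s2 n (\<lambda>_. x1) (\<lambda>_. x2)"
  let ?e = "\<lambda>x. (\<lambda>_. x)(Suc n := x ^ m)" and ?h = "\<lambda>i x. (\<lambda>_. x)(i := x ^ Suc m)"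
  have cyc: "wperm_moment s1 s2 (Suc n) ((?e x1)(i := ?e x1 i * ?e x1 (Suc n)))
                ((?e x2)(i := ?e x2 i * ?e x2 (Suc n))) =
        wperm_moment s1 s2 (Suc n) (?h n x1) (?h n x2)" if i: "i < Suc n" for i
  proof -
    have "wperm_moment s1 s2 (Suc n) ((?e x1)(i := ?e x1 i * ?e x1 (Suc n)))
                ((?e x2)(i := ?e x2 i * ?e x2 (Suc n))) =
          wperm_moment s1 s2 (Suc n) (?h i x1) (?h i x2)"
      using i by (intro wperm_moment_cong) auto
    \<comment> \<open>By symmetry the heavy point may be moved to the last position \<open>n\<close>.\<close>
    also have "\<dots> = wperm_moment s1 s2 (Suc n) (?h n x1 \<circ> Transposition.transpose i n)
        (?h n x2 \<circ> Transposition.transpose i n)"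
      by (intro wperm_moment_cong) (auto simp: Transposition.transpose_def)
    also have "\<dots> = wperm_moment s1 s2 (Suc n) (?h n x1) (?h n x2)"
      using i by (intro wperm_moment_transpose) auto
    finally show ?thesis .
  qed
  have "wperm_moment s1 s2 (Suc (Suc n)) (?e x1) (?e x2) =
      ?f m * wperm_moment s1 s2 (Suc n) (?e x1) (?e x2) +
      of_nat (Suc n) * wperm_moment s1 s2 (Suc n) (?h n x1) (?h n x2)"
  proof -
    have "wperm_moment s1 s2 (Suc (Suc n)) (?e x1) (?e x2) =
        ?f m * wperm_moment s1 s2 (Suc n) (?e x1) (?e x2) +
        (\<Sum>i<Suc n. wperm_moment s1 s2 (Suc n) (?h n x1) (?h n x2))"
    proof -
      have "(\<Sum>i<Suc n. wperm_moment s1 s2 (Suc n) ((?e x1)(i := ?e x1 i * ?e x1 (Suc n)))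
                ((?e x2)(i := ?e x2 i * ?e x2 (Suc n)))) =
          (\<Sum>i<Suc n. wperm_moment s1 s2 (Suc n) (?h n x1) (?h n x2))"
        by (rule sum.cong[OF refl cyc]) (simp only: lessThan_iff)
      thus ?thesis
        using wperm_moment_Suc[of s1 s2 "Suc n" "?e x1" "?e x2"] by (simp only: fun_upd_same)
    qed
    thus ?thesis by (simp del: of_nat_Suc)
  qed
  also have "wperm_moment s1 s2 (Suc n) (?e x1) (?e x2) = ?B (Suc n)"
    by (intro wperm_moment_cong) auto
  also have "of_nat (Suc n) * wperm_moment s1 s2 (Suc n) (?h n x1) (?h n x2) =
     (\<Sum>j\<le>n. ?f (m + Suc j) * (fact (Suc n) / fact (n - j)) * ?B (n - j))"
    unfolding Suc.IH sum_distrib_left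
    by (intro sum.cong refl) (simp add: mult_ac)
  also have "?f m * ?B (Suc n) + \<dots> =
     (\<Sum>j\<le>Suc n. ?f (m + j) * (fact (Suc n) / fact (Suc n - j)) * ?B (Suc n - j))"
    by (subst sum.atMost_Suc_shift) (simp del: fact_Suc)
  finally show ?case .
qed

lemma wperm_moment_recurrence:
  fixes x1 x2 :: "'a::field_char_0" and s1 s2 :: nat
  defines "a \<equiv> \<lambda>n. wperm_moment s1 s2 n (\<lambda>_. x1) (\<lambda>_. x2) / fact n"
  shows "of_nat (Suc n) * a (Suc n) =
    (\<Sum>j\<le>n. (1 - x1 ^ Suc j) ^ s1 * (1 - x2 ^ Suc j) ^ s2 * a (n - j))"
proof -
  have "of_nat (Suc n) * a (Suc n) = wperm_moment s1 s2 (Suc n) (\<lambda>_. x1) (\<lambda>_. x2) / fact n"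
    by (simp add: a_def field_simps del: of_nat_Suc)
  also have "wperm_moment s1 s2 (Suc n) (\<lambda>_. x1) (\<lambda>_. x2) =
      wperm_moment s1 s2 (Suc n) ((\<lambda>_. x1)(n := x1 ^ 1)) ((\<lambda>_. x2)(n := x2 ^ 1))"
    by (intro wperm_moment_cong) auto
  also have "\<dots> / fact n =
      (\<Sum>j\<le>n. (1 - x1 ^ Suc j) ^ s1 * (1 - x2 ^ Suc j) ^ s2 * a (n - j))"
    unfolding wperm_moment_long_cycle sum_divide_distrib by (intro sum.cong refl) (simp add: a_def)
  finally show ?thesis .
qed

section \<open>The product as a power series\<close>

lemma fps_deriv_power_int:
  fixes u :: "'a::field_char_0 fps"
  assumes u: "fps_nth u 0 \<noteq> 0"
  shows "fps_deriv (u powi c) = of_int c * fps_deriv u * inverse u * u powi c"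
proof -
  have iu: "inverse u * u = 1" using u by (rule inverse_mult_eq_1)
  have pow: "fps_deriv (v ^ k) = of_nat k * fps_deriv v * w * v ^ k"
    if wv: "w * v = 1" for v w :: "'a fps" and k
  proof (induction k)
    case (Suc k)
    have "fps_deriv (v ^ Suc k) = v * fps_deriv (v ^ k) + fps_deriv v * v ^ k" by simp
    also have "\<dots> = of_nat k * fps_deriv v * w * v ^ Suc k + fps_deriv v * (w * v) * v ^ k"
      unfolding Suc.IH wv by (simp add: mult_ac)
    finally show ?case by (simp add: algebra_simps)
  qed simp
  show ?thesis
  proof (cases "c \<ge> 0")
    case True
    then show ?thesis by (simp add: power_int_def pow[OF iu])
  next
    case False
    have "fps_deriv (inverse u) = - fps_deriv u * (inverse u)\<^sup>2"
      using u by (rule fps_inverse_deriv)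
    moreover have "of_nat (nat (- c)) = (- of_int c :: 'a fps)" using False by simp
    ultimately show ?thesis using False iu
      by (simp add: power_int_def pow[of u "inverse u"] mult.commute[of u] power2_eq_square)
  qed
qed

lemma fps_deriv_prod_log:
  fixes u :: "'b \<Rightarrow> 'a::comm_ring_1 fps"
  assumes "finite K" and "\<And>k. k \<in> K \<Longrightarrow> fps_deriv (u k) = l k * u k"
  shows "fps_deriv (prod u K) = sum l K * prod u K"
  using assms by (induction K rule: finite_induct) (simp_all add: algebra_simps)

lemma fps_nth_inverse_geometric:
  fixes c :: "'a::field"
  shows "fps_nth (inverse (1 - fps_const c * fps_X)) n = c ^ n"
proof -
  have "(1 - fps_const c * fps_X) * Abs_fps (\<lambda>n. c ^ n) = 1"
  proof (rule fps_ext)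
    fix n show "fps_nth ((1 - fps_const c * fps_X) * Abs_fps (\<lambda>n. c ^ n)) n = fps_nth 1 n"
      by (cases n) (simp_all add: algebra_simps mult.assoc)
  qed
  hence "inverse (1 - fps_const c * fps_X) = Abs_fps (\<lambda>n. c ^ n)"
    by (rule fps_inverse_unique)
  thus ?thesis by simp
qed

lemma binomial_1_minus:
  fixes z :: "'a::comm_ring_1"
  shows "(1 - z) ^ s = (\<Sum>k=0..s. of_nat (s choose k) * (-1) ^ k * z ^ k)"
  using binomial_ring[of "- z" 1 s]
  by (simp add: power_minus[of z] mult_ac atMost_atLeast0)

text \<open>The recurrence is the coefficient form of \<open>R' = H R\<close>, where \<open>H\<close> is the logarithmic
  derivative of \<open>R\<close>; the factor \<open>(1 - y t)^c\<close> contributes \<open>- c y / (1 - y t)\<close> to \<open>H\<close>.\<close>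

lemma weyl_fps_recurrence:
  fixes x1 x2 :: "'a::field_char_0" and s1 s2 :: nat
  defines "R \<equiv> \<Prod>k1=0..s1. \<Prod>k2=0..s2.
     (1 - fps_const (x1 ^ k1 * x2 ^ k2) * fps_X) powi
       (int (s1 choose k1) * int (s2 choose k2) * (-1) ^ (k1 + k2 + 1))"
  shows "of_nat (Suc n) * fps_nth R (Suc n) =
           (\<Sum>j\<le>n. (1 - x1 ^ Suc j) ^ s1 * (1 - x2 ^ Suc j) ^ s2 * fps_nth R (n - j))"
    and "fps_nth R 0 = 1"
proof -
  define K where "K = {0..s1} \<times> {0..s2}"
  define y where "y = (\<lambda>(k1, k2). x1 ^ k1 * x2 ^ k2)"
  define c where "c = (\<lambda>(k1, k2). int (s1 choose k1) * int (s2 choose k2) * (-1) ^ (k1 + k2 + 1))"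
  define u where "u k = 1 - fps_const (y k) * fps_X" for k
  define l where "l k = of_int (c k) * fps_deriv (u k) * inverse (u k)" for k
  have R: "R = (\<Prod>k\<in>K. u k powi c k)"
    by (simp add: R_def K_def u_def y_def c_def prod.cartesian_product case_prod_beta)
  have u0: "fps_nth (u k) 0 = 1" for k by (simp add: u_def)
  have "fps_nth (v powi c) 0 = 1" if "fps_nth v 0 = 1" for v :: "'a fps" and c
    using that by (simp add: power_int_def fps_power_zeroth)
  hence c0: "fps_nth (u k powi c k) 0 = 1" for k using u0 by blast
  have "fps_nth (\<Prod>k\<in>A. u k powi c k) 0 = 1" for A
    by (induction A rule: infinite_finite_induct) (simp_all add: c0)
  thus "fps_nth R 0 = 1" by (simp add: R)
  have "fps_deriv R = sum l K * R"
    unfolding R by (rule fps_deriv_prod_log) (auto simp: K_def l_def fps_deriv_power_int u0)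
  moreover have lK: "fps_nth (sum l K) j = (1 - x1 ^ Suc j) ^ s1 * (1 - x2 ^ Suc j) ^ s2" for j
  proof -
    have "l k = fps_const (- of_int (c k) * y k) * inverse (1 - fps_const (y k) * fps_X)" for k
    proof -
      have "of_int (c k) = fps_const (of_int (c k) :: 'a)" by (simp add: fps_of_int)
      moreover have "fps_deriv (u k) = fps_const (- y k)" by (simp add: u_def)
      ultimately have "l k = fps_const (of_int (c k)) * fps_const (- y k) * inverse (u k)"
        by (simp only: l_def)
      thus ?thesis by (simp add: u_def)
    qed
    hence "fps_nth (sum l K) j = (\<Sum>k\<in>K. - of_int (c k) * y k ^ Suc j)"
      by (simp add: fps_sum_nth fps_nth_inverse_geometric mult.assoc)
    also have "\<dots> = (\<Sum>k1=0..s1. \<Sum>k2=0..s2.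
        (of_nat (s1 choose k1) * (-1) ^ k1 * (x1 ^ Suc j) ^ k1) *
        (of_nat (s2 choose k2) * (-1) ^ k2 * (x2 ^ Suc j) ^ k2))"
    proof -
      have "- of_int (c (a, b)) * y (a, b) ^ m =
          (of_nat (s1 choose a) * (-1) ^ a * (x1 ^ m) ^ a) *
          (of_nat (s2 choose b) * (-1) ^ b * (x2 ^ m) ^ b)" for a b m
      proof -
        have pw: "(x ^ k) ^ m = (x ^ m) ^ k" for x :: 'a and k
          by (simp only: power_mult [symmetric] mult.commute)
        have "y (a, b) ^ m = (x1 ^ m) ^ a * (x2 ^ m) ^ b"
          by (simp add: y_def power_mult_distrib pw)
        thus ?thesis by (simp add: c_def power_add)
      qed
      thus ?thesis unfolding K_def sum.cartesian_product 
        by (intro sum.cong refl) (simp only: split_paired_all prod.case)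
    qed
    also have "\<dots> = (1 - x1 ^ Suc j) ^ s1 * (1 - x2 ^ Suc j) ^ s2"
      unfolding binomial_1_minus by (rule sum_product [symmetric])
    finally show ?thesis .
  qed
  ultimately have "fps_nth (fps_deriv R) n =
      (\<Sum>j=0..n. (1 - x1 ^ Suc j) ^ s1 * (1 - x2 ^ Suc j) ^ s2 * fps_nth R (n - j))"
    by (simp add: fps_mult_nth del: fps_deriv_nth power_Suc)
  thus "of_nat (Suc n) * fps_nth R (Suc n) =
      (\<Sum>j\<le>n. (1 - x1 ^ Suc j) ^ s1 * (1 - x2 ^ Suc j) ^ s2 * fps_nth R (n - j))"
    by (simp add: atMost_atLeast0)
qed

lemma wperm_moment_eq_fps_nth:
  fixes x1 x2 :: "'a::field_char_0" and s1 s2 :: nat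
  shows "wperm_moment s1 s2 n (\<lambda>_. x1) (\<lambda>_. x2) / fact n =
    fps_nth (\<Prod>k1=0..s1. \<Prod>k2=0..s2.
     (1 - fps_const (x1 ^ k1 * x2 ^ k2) * fps_X) powi
       (int (s1 choose k1) * int (s2 choose k2) * (-1) ^ (k1 + k2 + 1))) n"
    (is "?a n = fps_nth ?R n")
proof (induction n rule: less_induct)
  case (less n)
  show ?case
  proof (cases n)
    case 0
    then show ?thesis using weyl_fps_recurrence(2)
        [where ?s1.0 = s1 and ?s2.0 = s2 and ?x1.0 = x1 and ?x2.0 = x2] by simp
  next
    case (Suc m)
    have "of_nat (Suc m) * ?a (Suc m) = of_nat (Suc m) * fps_nth ?R (Suc m)"
      unfolding wperm_moment_recurrence weyl_fps_recurrence(1)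
      using less.IH Suc by (intro sum.cong refl) simp
    thus ?thesis using Suc by (simp only: mult_cancel_left of_nat_eq_0_iff) simp
  qed
qed

section \<open>The determinant on the sum-zero subspace\<close>

text \<open>The basis \<open>e\<^sub>j - e\<^sub>m\<close>, for \<open>j < m\<close>, of the sum-zero subspace of \<open>\<complex>\<close>-vectors indexed by
  \<open>0, \<dots>, m\<close>.\<close>

definition sum_zero_basis :: "nat \<Rightarrow> complex vec list" where
  "sum_zero_basis m =
     map (\<lambda>j. vec (Suc m) (\<lambda>i. (if i = j then 1 else 0) - (if i = m then 1 else 0))) [0..<m]"

lemma mat_of_cols_sum_zero_basis:
  "mat_of_cols (Suc m) (sum_zero_basis m) =
     mat (Suc m) m (\<lambda>(i, j). (if i = j then 1 else 0) - (if i = m then 1 else 0))"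
  by (intro eq_matI) (auto simp: sum_zero_basis_def mat_of_cols_def)

lemma sum_zero_basis_mult_vec:
  assumes v: "v \<in> carrier_vec m"
  shows "mat_of_cols (Suc m) (sum_zero_basis m) *\<^sub>v v =
    vec (Suc m) (\<lambda>i. if i = m then - (\<Sum>j<m. v $ j) else v $ i)"
proof (rule eq_vecI)
  fix i assume "i < dim_vec (vec (Suc m) (\<lambda>i. if i = m then - (\<Sum>j<m. v $ j) else v $ i))"
  hence i: "i < Suc m" by simp
  let ?U = "mat_of_cols (Suc m) (sum_zero_basis m)"
  have "(?U *\<^sub>v v) $ i = (\<Sum>j<m. ((if i = j then 1 else 0) - (if i = m then 1 else 0)) * v $ j)"
    using v i by (simp add: mat_of_cols_sum_zero_basis scalar_prod_def atLeast0LessThan)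
  also have "\<dots> = (if i = m then - (\<Sum>j<m. v $ j) else v $ i)"
    using i by (auto simp: sum_negf if_distrib[of "\<lambda>a. a * _"] cong: if_cong)
  finally show "(?U *\<^sub>v v) $ i = vec (Suc m) (\<lambda>i. if i = m then - (\<Sum>j<m. v $ j) else v $ i) $ i"
    using i by simp
qed (simp add: mat_of_cols_def)

lemma is_basis_list_sum_zero_basis:
  "is_basis_list (Suc m) (sum_zero_space (Suc m)) (sum_zero_basis m)"
proof -
  interpret vec_space "TYPE(complex)" "Suc m" .
  let ?vs = "sum_zero_basis m" and ?U = "mat_of_cols (Suc m) (sum_zero_basis m)"
  have len: "length ?vs = m" by (simp add: sum_zero_basis_def)
  have sub: "set ?vs \<subseteq> carrier_vec (Suc m)" by (auto simp: sum_zero_basis_def)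
  have U: "?U \<in> carrier_mat (Suc m) m" using mat_of_cols_carrier(1)[of "Suc m" ?vs] by (simp add: len)
  have cU: "cols ?U = ?vs" using sub by simp
  have dist: "distinct ?vs"
  proof (unfold distinct_conv_nth len, intro allI impI)
    fix i j assume ij: "i < m" "j < m" "i \<noteq> j"
    have "?vs ! i $ i \<noteq> ?vs ! j $ i" using ij by (simp add: sum_zero_basis_def)
    thus "?vs ! i \<noteq> ?vs ! j" by auto
  qed
  have "\<not> lin_dep (set ?vs)"
  proof
    assume "lin_dep (set ?vs)"
    then obtain v where v: "v \<in> carrier_vec m" "v \<noteq> 0\<^sub>v m" "?U *\<^sub>v v = 0\<^sub>v (Suc m)"
      using lin_depE[OF U] dist cU by metis
    have "v $ i = 0" if i: "i < m" for i
      using arg_cong[OF v(3), of "\<lambda>w. w $ i"] i unfolding sum_zero_basis_mult_vec[OF v(1)] by simp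
    hence "v = 0\<^sub>v m" using v(1) by (intro eq_vecI) auto
    with v(2) show False ..
  qed
  moreover have "span (set ?vs) = sum_zero_space (Suc m)"
  proof -
    have "span (set ?vs) = {y \<in> carrier_vec (Suc m). \<exists>x\<in>carrier_vec m. ?U *\<^sub>v x = y}"
      using col_space_eq[OF U] U by (simp add: col_space_def cU len)
    also have "\<dots> = sum_zero_space (Suc m)"
    proof (intro equalityI subsetI)
      fix y assume "y \<in> {y \<in> carrier_vec (Suc m). \<exists>x\<in>carrier_vec m. ?U *\<^sub>v x = y}"
      then obtain x where "x \<in> carrier_vec m" "y = ?U *\<^sub>v x" by auto
      thus "y \<in> sum_zero_space (Suc m)"
        by (simp add: sum_zero_basis_mult_vec sum_zero_space_def)
    next
      fix y assume "y \<in> sum_zero_space (Suc m)"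
      hence y: "y \<in> carrier_vec (Suc m)" "(\<Sum>j<m. y $ j) + y $ m = 0"
        by (auto simp: sum_zero_space_def)
      have "?U *\<^sub>v vec m (\<lambda>i. y $ i) = y"
        using y by (subst sum_zero_basis_mult_vec)
          (auto intro!: eq_vecI simp: neg_eq_iff_add_eq_0 less_Suc_eq)
      moreover have "vec m (\<lambda>i. y $ i) \<in> carrier_vec m" by simp
      ultimately show "y \<in> {y \<in> carrier_vec (Suc m). \<exists>x\<in>carrier_vec m. ?U *\<^sub>v x = y}"
        using y(1) by blast
    qed
    finally show ?thesis .
  qed
  ultimately show ?thesis using sub dist by (simp add: is_basis_list_def)
qed

text \<open>If all column sums of \<open>F\<close> equal \<open>c\<close>, then \<open>F\<close> preserves the sum-zero subspace. Extending the
  basis \<open>e\<^sub>j - e\<^sub>m\<close> by \<open>e\<^sub>m\<close> (the columns of \<open>U\<close> below) turns \<open>F\<close> into a block upper triangular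
  matrix \<open>N\<close>, whose diagonal blocks are the matrix \<open>M\<close> of the restriction and the scalar \<open>c\<close>.\<close>

lemma det_eq_mult_det_on_sum_zero_space:
  fixes F :: "complex mat"
  assumes F: "F \<in> carrier_mat (Suc m) (Suc m)"
    and cs: "\<And>j. j \<le> m \<Longrightarrow> (\<Sum>i\<le>m. F $$ (i, j)) = c"
  shows "det F = c * det_on (Suc m) (sum_zero_space (Suc m)) F"
proof -
  let ?vs = "sum_zero_basis m"
  let ?V = "mat_of_cols (Suc m) ?vs"
  define M where "M = mat m m (\<lambda>(i, j). F $$ (i, j) - F $$ (i, m))"
  define U where "U = mat (Suc m) (Suc m)
    (\<lambda>(i, j). (if i = j then 1 else 0) - (if i = m \<and> j < m then 1 else 0 :: complex))"
  define N where "N = mat (Suc m) (Suc m)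
    (\<lambda>(i, j). if i = m then (if j = m then c else 0)
              else F $$ (i, j) - (if j < m then F $$ (i, m) else 0))"
  have U: "U \<in> carrier_mat (Suc m) (Suc m)" and N: "N \<in> carrier_mat (Suc m) (Suc m)"
    by (auto simp: U_def N_def)
  have len: "length ?vs = m" by (simp add: sum_zero_basis_def)
  have last: "F $$ (m, j) = c - (\<Sum>i<m. F $$ (i, j))" if "j \<le> m" for j
    using cs[OF that] by (simp add: eq_diff_eq add.commute flip: lessThan_Suc_atMost)
  have FU: "F * U = U * N"
  proof (rule eq_matI)
    fix i j assume "i < dim_row (U * N)" "j < dim_col (U * N)"
    hence ij: "i < Suc m" "j < Suc m" using U N by auto
    have "(F * U) $$ (i, j) = (\<Sum>k<Suc m. F $$ (i, k) * U $$ (k, j))"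
      using F U ij by (simp add: scalar_prod_def atLeast0LessThan)
    also have "\<dots> = (\<Sum>k<Suc m. (if k = j then F $$ (i, j) else 0) -
        (if k = m then if j < m then F $$ (i, m) else 0 else 0))"
      using ij by (intro sum.cong) (auto simp: U_def)
    also have "\<dots> = F $$ (i, j) - (if j < m then F $$ (i, m) else 0)"
      using ij by (simp add: sum_subtractf del: sum.lessThan_Suc)
    also have "\<dots> = (\<Sum>k<Suc m. U $$ (i, k) * N $$ (k, j))"
    proof (cases "i = m")
      case True
      have "(\<Sum>k<Suc m. U $$ (i, k) * N $$ (k, j)) = N $$ (m, j) - (\<Sum>k<m. N $$ (k, j))"
        using True by (simp add: U_def sum_negf del: upt_Suc)
      also have "\<dots> = F $$ (i, j) - (if j < m then F $$ (i, m) else 0)"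
        using ij True by (cases "j < m") (simp_all add: N_def last sum_subtractf less_Suc_eq)
      finally show ?thesis ..
    next
      case False
      hence "(\<Sum>k<Suc m. U $$ (i, k) * N $$ (k, j)) = (\<Sum>k<Suc m. if k = i then N $$ (i, j) else 0)"
        using ij by (intro sum.cong) (auto simp: U_def)
      also have "\<dots> = N $$ (i, j)" using ij by (simp del: sum.lessThan_Suc)
      finally show ?thesis using False ij by (simp add: N_def)
    qed
    also have "\<dots> = (U * N) $$ (i, j)"
      using N U ij by (simp add: scalar_prod_def atLeast0LessThan)
    finally show "(F * U) $$ (i, j) = (U * N) $$ (i, j)" .
  qed (use F U N in auto)
  have FV: "F * ?V = ?V * M"
  proof (rule eq_matI)
    fix i j assume "i < dim_row (?V * M)" "j < dim_col (?V * M)"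
    hence ij: "i < Suc m" "j < m" by (auto simp: M_def)
    have "(F * ?V) $$ (i, j) = (F * U) $$ (i, j)"
      using F U ij by (auto simp: scalar_prod_def mat_of_cols_sum_zero_basis U_def intro!: sum.cong)
    also have "\<dots> = (?V * M) $$ (i, j)"
      unfolding FU using U N ij
      by (auto simp: scalar_prod_def mat_of_cols_sum_zero_basis U_def N_def M_def intro!: sum.cong)
    finally show "(F * ?V) $$ (i, j) = (?V * M) $$ (i, j)" .
  qed (use F in \<open>auto simp: M_def len\<close>)
  have "det_on (Suc m) (sum_zero_space (Suc m)) F = det M"
    by (rule det_on_eqI[OF F is_basis_list_sum_zero_basis _ FV]) (simp add: M_def len)
  moreover have "det U = 1"
  proof -
    have "det U = prod_list (diag_mat U)"
      by (rule det_lower_triangular[OF _ U]) (simp add: U_def)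
    also have "diag_mat U = replicate (Suc m) 1"
      by (intro nth_equalityI) (auto simp: diag_mat_def U_def simp del: replicate_Suc upt_Suc)
    finally show ?thesis by simp
  qed
  moreover have "det N = c * det M"
  proof -
    have "mat m m (\<lambda>ij. N $$ ij) = M" by (intro eq_matI) (auto simp: N_def M_def)
    thus ?thesis by (subst det_last_row_zero[OF N]) (auto simp: N_def)
  qed
  moreover have "det F * det U = det U * det N"
    using det_mult[OF F U] det_mult[OF U N] FU by metis
  ultimately show ?thesis by simp
qed

lemma Z_weyl_SU_eq:
  assumes p: "p permutes {..<n}" and n: "n \<ge> 1" and x: "x \<noteq> 1"
  shows "Z_weyl_SU n x p = det (wperm_matrix n (\<lambda>_. x) p) / (1 - x)"
proof -
  obtain m where m: "n = Suc m" using n by (cases n) auto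
  let ?F = "wperm_matrix n (\<lambda>_. x) p"
  have F: "1\<^sub>m n - x \<cdot>\<^sub>m perm_matrix n p = ?F"
    by (intro eq_matI) (auto simp: wperm_matrix_def perm_matrix_def)
  have "(\<Sum>i\<le>m. ?F $$ (i, j)) = 1 - x" if j: "j \<le> m" for j
  proof -
    have "p j \<le> m" using permutes_in_image[OF p, of j] j m by auto
    have "(\<Sum>i\<le>m. ?F $$ (i, j)) = (\<Sum>i\<le>m. (if i = j then 1 else 0) - (if i = p j then x else 0))"
      using j m by (intro sum.cong) (auto simp: wperm_matrix_def)
    thus ?thesis using j \<open>p j \<le> m\<close> by (simp add: sum_subtractf)
  qed
  from det_eq_mult_det_on_sum_zero_space[OF _ this] x show ?thesis
    by (simp add: Z_weyl_SU_def F[unfolded m] m)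
qed

section \<open>The expectation\<close>

theorem mainTheorem8:
  fixes n s1 s2 :: nat and x1 x2 :: complex
  assumes "n \<ge> 1" and "x1 \<noteq> 1" and "x2 \<noteq> 1"
  shows "measure_pmf.expectation (pmf_of_set {p. p permutes {..<n}})
           (\<lambda>p. Z_weyl_SU n x1 p ^ s1 * Z_weyl_SU n x2 p ^ s2) =
         fps_nth
           ((\<Prod>k1=0..s1. \<Prod>k2=0..s2.
               (1 - fps_const (x1 ^ k1 * x2 ^ k2) * fps_X) powi
                 (int (s1 choose k1) * int (s2 choose k2) * (-1) ^ (k1 + k2 + 1))) /
            fps_const ((1 - x1) ^ s1 * (1 - x2) ^ s2)) n"
proof -
  let ?P = "{p. p permutes {..<n}}" and ?d = "(1 - x1) ^ s1 * (1 - x2) ^ s2"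
  have fin: "finite ?P" by (intro finite_permutations) simp
  have ne: "?P \<noteq> {}" using permutes_id[of "{..<n}"] by blast
  have d: "?d \<noteq> 0" using assms by simp
  have "measure_pmf.expectation (pmf_of_set ?P) (\<lambda>p. Z_weyl_SU n x1 p ^ s1 * Z_weyl_SU n x2 p ^ s2) =
        (\<Sum>p\<in>?P. pmf (pmf_of_set ?P) p *\<^sub>R (Z_weyl_SU n x1 p ^ s1 * Z_weyl_SU n x2 p ^ s2))"
    by (rule integral_measure_pmf[OF fin]) (use fin ne in auto)
  also have "\<dots> = (\<Sum>p\<in>?P. det (wperm_matrix n (\<lambda>_. x1) p) ^ s1 *
       det (wperm_matrix n (\<lambda>_. x2) p) ^ s2 / (fact n * ?d))"
    using assms fin ne
    by (intro sum.cong refl)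
       (simp add: Z_weyl_SU_eq card_permutations power_divide scaleR_conv_of_real field_simps)
  also have "\<dots> = wperm_moment s1 s2 n (\<lambda>_. x1) (\<lambda>_. x2) / fact n / ?d"
    by (simp add: wperm_moment_def sum_divide_distrib)
  finally show ?thesis
    unfolding wperm_moment_eq_fps_nth using d by (simp add: fps_divide_unit fps_const_inverse divide_inverse)
qed

end
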